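(* Let $n\ge 2$, let $c\in\mathbb R$ be a constant, and let $u\in L^2_{loc}(\mathbb R^n)$ be a real-valued eigenfunction of $-\Delta$ on $\mathbb R^n$ (so $u\not\equiv 0$) with $$-\Delta u=c^2u\quad\text{on }\mathbb R^n .$$ Then $u$ does not vanish to infinite order in the $L^2$ sense at $\infty$; namely, there exists some $N\ge 0$ such that $\limsup_{r\to\infty} r^N\int_{|x|>r}|u|^2=\infty$.
   Context: The equation is understood in the weak (distributional) sense, and an eigenfunction is by definition not identically zero. A function $u\in L^2_{loc}(\mathbb R^n)$ vanishes to infinite order in the $L^2$ sense at infinity if $\lim_{r\to\infty} r^m\int_{|x|>r}|u|^2=0$ for every $m\ge 0$. Integrals are allowed to take the value $+\infty$. *)

theory Defs
  imports "HOL-Analysis.Analysis"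
begin

definition partial_deriv :: "'a::euclidean_space \<Rightarrow> ('a \<Rightarrow> real) \<Rightarrow> 'a \<Rightarrow> real" where
  "partial_deriv b f = (\<lambda>x. frechet_derivative f (at x) b)"

definition laplacian :: "('a::euclidean_space \<Rightarrow> real) \<Rightarrow> 'a \<Rightarrow> real" where
  "laplacian f = (\<lambda>x. \<Sum>b\<in>Basis. partial_deriv b (partial_deriv b f) x)"

fun C_k :: "nat \<Rightarrow> ('a::euclidean_space \<Rightarrow> real) \<Rightarrow> bool" where
  "C_k 0 f \<longleftrightarrow> continuous_on UNIV f"
| "C_k (Suc k) f \<longleftrightarrow> f differentiable_on UNIV \<and> (\<forall>b\<in>Basis. C_k k (partial_deriv b f))"

definition test_function :: "('a::euclidean_space \<Rightarrow> real) \<Rightarrow> bool" where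
  "test_function \<phi> \<longleftrightarrow> (\<forall>k. C_k k \<phi>) \<and> compact (closure {x. \<phi> x \<noteq> 0})"

definition L2_loc :: "('a::euclidean_space \<Rightarrow> real) set" where
  "L2_loc = {u \<in> borel_measurable lebesgue.
     \<forall>K. compact K \<longrightarrow> set_integrable lebesgue K (\<lambda>x. \<bar>u x\<bar>\<^sup>2)}"

text \<open>The distributional form of the equation \<open>- \<Delta> u = \<mu> u\<close> on the whole space. For
  \<open>u\<close> in \<open>L2_loc\<close> both integrands are integrable.\<close>

definition weak_helmholtz :: "real \<Rightarrow> ('a::euclidean_space \<Rightarrow> real) \<Rightarrow> bool" where
  "weak_helmholtz \<mu> u \<longleftrightarrow>
     (\<forall>\<phi>. test_function \<phi> \<longrightarrow>
        (\<integral>x. u x * (- laplacian \<phi> x) \<partial>lebesgue) = \<mu> * (\<integral>x. u x * \<phi> x \<partial>lebesgue))"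

text \<open>Functions in \<open>L2_loc\<close> are identified up to null sets, so being not identically zero
  means being nonzero on a set of positive measure.\<close>

definition eigenfunction_neg_laplacian :: "real \<Rightarrow> ('a::euclidean_space \<Rightarrow> real) \<Rightarrow> bool" where
  "eigenfunction_neg_laplacian \<mu> u \<longleftrightarrow>
     u \<in> L2_loc \<and> weak_helmholtz \<mu> u \<and> \<not> (AE x in lebesgue. u x = 0)"

definition L2_tail :: "('a::euclidean_space \<Rightarrow> real) \<Rightarrow> real \<Rightarrow> ennreal" where
  "L2_tail u r = (\<integral>\<^sup>+x\<in>{x. norm x > r}. ennreal (\<bar>u x\<bar>\<^sup>2) \<partial>lebesgue)"

definition vanishes_infinite_order_at_infinity :: "('a::euclidean_space \<Rightarrow> real) \<Rightarrow> bool" where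
  "vanishes_infinite_order_at_infinity u \<longleftrightarrow>
     (\<forall>m\<ge>0. ((\<lambda>r. ennreal (r powr m) * L2_tail u r) \<longlongrightarrow> 0) at_top)"

end

theory Submission
  imports Defs "HOL-Probability.Levy"
begin

text \<open>
  Suppose the weighted tails \<open>r\<^sup>N \<integral>\<^bsub>|x| > r\<^esub> |u|\<^sup>2\<close> stay bounded for the single exponent \<open>N = n + 2\<close>. Summing over dyadic annuli,
  this much decay puts \<open>u\<close> in \<open>L\<^sup>1\<close> (\<open>integrable_of_L2_tail_decay\<close>), so its Fourier transform is a continuous function. The
  equation multiplies the transform by \<open>|\<xi>|\<^sup>2 - c\<^sup>2\<close> and says that the product is zero
  (\<open>helmholtz_fourier_supported_on_sphere\<close>): the transform lives on the sphere \<open>|\<xi>| = |c|\<close>. A continuous function that vanishes off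
  a sphere vanishes everywhere (\<open>helmholtz_fourier_zero\<close>), and an integrable function with zero Fourier transform is zero
  almost everywhere (\<open>zero_fourier_imp_AE_zero\<close>). That is impossible for an eigenfunction, so the upper limit is infinite for
  \<open>N = n + 2\<close>, and in particular \<open>u\<close> does not vanish to infinite order.

  To transform the weak equation one has to test it with plane waves, which lack compact support. They are truncated by an
  explicit cutoff built from \<open>exp (- 1 / t)\<close>, and integrability of \<open>u\<close> allows the truncation to be removed by dominated
  convergence. All transforms are real: they are the integrals of \<open>u\<close> against \<open>cos (x \<bullet> \<xi> + \<theta>)\<close> for all phases \<open>\<theta>\<close>. Uniqueness of
  the transform is reduced to the theorem of Levy on the line, one coordinate at a time.
\<close>

section \<open>Calculus of smooth functions\<close>

lemma partial_deriv_eqI: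
  assumes "(f has_derivative f') (at x)"
  shows "partial_deriv b f x = f' b"
  using frechet_derivative_at[OF assms] by (simp add: partial_deriv_def)

text \<open>The predicate \<^const>\<open>C_k\<close> unfolds through \<^const>\<open>frechet_derivative\<close>, an unspecified choice that
  does not compute. The next two rules trade it for an arbitrary derivative supplied as a
  \<open>has_derivative\<close> fact, which is what makes inductions on \<open>k\<close> practicable.\<close>

lemma C_k_SucI:
  assumes "\<And>x. (f has_derivative f' x) (at x)"
    and "\<And>b. b \<in> Basis \<Longrightarrow> C_k k (\<lambda>x. f' x b)"
  shows "C_k (Suc k) f"
proof -
  have "partial_deriv b f = (\<lambda>x. f' x b)" for b
    by (rule ext, rule partial_deriv_eqI, rule assms(1))
  moreover have "f differentiable_on UNIV"
    using assms(1) by (auto simp: differentiable_on_def differentiable_def)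
  ultimately show ?thesis
    using assms(2) by simp
qed

lemma C_k_SucE:
  assumes "C_k (Suc k) f"
  obtains f' where "\<And>x. (f has_derivative f' x) (at x)"
    and "\<And>b. b \<in> Basis \<Longrightarrow> C_k k (\<lambda>x. f' x b)"
proof
  show der: "(f has_derivative frechet_derivative f (at x)) (at x)" for x
    using assms frechet_derivative_works[of f "at x"]
    by (auto simp: differentiable_on_def)
  show "C_k k (\<lambda>x. frechet_derivative f (at x) b)" if "b \<in> Basis" for b
    using assms that by (simp add: partial_deriv_def)
qed

lemma C_k_Suc_imp_C_k: "C_k (Suc k) f \<Longrightarrow> C_k k f"
proof (induction k arbitrary: f)
  case 0
  then show ?case by (auto intro: differentiable_imp_continuous_on)
next
  case (Suc k)
  then obtain f' where "\<And>x. (f has_derivative f' x) (at x)"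
    and "\<And>b. b \<in> Basis \<Longrightarrow> C_k (Suc k) (\<lambda>x. f' x b)"
    by (elim C_k_SucE) blast
  then show ?case
    using Suc.IH by (intro C_k_SucI) blast+
qed

lemma C_k_const: "C_k k (\<lambda>x. a)"
proof (induction k arbitrary: a)
  case (Suc k)
  show ?case by (rule C_k_SucI[where f' = "\<lambda>x h. 0"]) (auto intro: Suc)
qed simp

lemma C_k_add:
  assumes "C_k k f" "C_k k g"
  shows "C_k k (\<lambda>x. f x + g x)"
  using assms
proof (induction k arbitrary: f g)
  case 0
  then show ?case by (auto intro: continuous_intros)
next
  case (Suc k)
  obtain f' where f: "\<And>x. (f has_derivative f' x) (at x)"
    "\<And>b. b \<in> Basis \<Longrightarrow> C_k k (\<lambda>x. f' x b)"
    using Suc.prems(1) by (elim C_k_SucE) blast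
  obtain g' where g: "\<And>x. (g has_derivative g' x) (at x)"
    "\<And>b. b \<in> Basis \<Longrightarrow> C_k k (\<lambda>x. g' x b)"
    using Suc.prems(2) by (elim C_k_SucE) blast
  show ?case
    by (rule C_k_SucI, rule has_derivative_add[OF f(1) g(1)], rule Suc.IH[OF f(2) g(2)])
qed

text \<open>The product rule returns \<open>f\<close> and \<open>g\<close> themselves, which are only known to be one order smoother
  than the induction hypothesis asks for; this is where \<open>C_k_Suc_imp_C_k\<close> enters.\<close>

lemma C_k_mult:
  assumes "C_k k f" "C_k k g"
  shows "C_k k (\<lambda>x. f x * g x)"
  using assms
proof (induction k arbitrary: f g)
  case 0
  then show ?case by (auto intro: continuous_intros)
next
  case (Suc k)
  obtain f' where f: "\<And>x. (f has_derivative f' x) (at x)"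
    "\<And>b. b \<in> Basis \<Longrightarrow> C_k k (\<lambda>x. f' x b)"
    using Suc.prems(1) by (elim C_k_SucE) blast
  obtain g' where g: "\<And>x. (g has_derivative g' x) (at x)"
    "\<And>b. b \<in> Basis \<Longrightarrow> C_k k (\<lambda>x. g' x b)"
    using Suc.prems(2) by (elim C_k_SucE) blast
  show ?case
    by (rule C_k_SucI, rule has_derivative_mult[OF f(1) g(1)])
       (rule C_k_add[OF Suc.IH[OF C_k_Suc_imp_C_k[OF Suc.prems(1)] g(2)]
          Suc.IH[OF f(2) C_k_Suc_imp_C_k[OF Suc.prems(2)]]])
qed

lemma C_k_inner: "C_k k (\<lambda>x. x \<bullet> b)"
proof (cases k)
  case (Suc j)
  show ?thesis unfolding Suc
    by (rule C_k_SucI[where f' = "\<lambda>x h. h \<bullet> b"])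
       (auto intro!: derivative_eq_intros C_k_const)
qed (auto intro: continuous_intros)

text \<open>Keeping the phase \<open>\<theta>\<close> arbitrary closes the induction: differentiating a cosine only shifts
  its phase by \<open>\<pi> / 2\<close>, so sines need no separate treatment. Here and later, the real and imaginary
  parts of a Fourier transform are the cases \<open>\<theta> = 0\<close> and \<open>\<theta> = - \<pi> / 2\<close>.\<close>

lemma C_k_plane_wave: "C_k k (\<lambda>x. cos (x \<bullet> \<xi> + \<theta>))"
proof (induction k arbitrary: \<theta>)
  case 0
  show ?case unfolding C_k.simps by (intro continuous_intros)
next
  case (Suc k)
  have wave': "- sin (x \<bullet> \<xi> + \<theta>) = cos (x \<bullet> \<xi> + (\<theta> + pi/2))" for x
    by (simp add: add.assoc[symmetric] cos_add)
  show ?case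
  proof (rule C_k_SucI)
    show "((\<lambda>x. cos (x \<bullet> \<xi> + \<theta>)) has_derivative
        (\<lambda>h. (h \<bullet> \<xi>) * cos (x \<bullet> \<xi> + (\<theta> + pi/2)))) (at x)" for x
      unfolding wave'[symmetric] by (auto intro!: derivative_eq_intros)
    show "C_k k (\<lambda>x. (b \<bullet> \<xi>) * cos (x \<bullet> \<xi> + (\<theta> + pi/2)))" for b
      by (intro C_k_mult C_k_const Suc)
  qed
qed

section \<open>Smoothly truncated plane waves\<close>

text \<open>The standard flat function \<open>exp (- 1 / t)\<close> is the case \<open>j = 0\<close>. The powers of \<open>1 / t\<close> are included
  because the span of this family is closed under differentiation.\<close>

definition flat :: "nat \<Rightarrow> real \<Rightarrow> real" where
  "flat j t = (if t > 0 then (1 / t) ^ j * exp (- (1 / t)) else 0)"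

lemma flat_nonneg: "0 \<le> flat j t"
  by (simp add: flat_def)

text \<open>With \<open>y = 1 / t\<close> this is \<open>y\<^sup>j / j! \<le> e\<^sup>y\<close>, a single term of the exponential series. The bound holds
  for all \<open>t\<close>, so the estimates on the cutoff are uniform in \<open>x\<close> and in its radius.\<close>

lemma flat_le_fact: "flat j t \<le> fact j"
proof (cases "t > 0")
  case True
  have "(1 / t) ^ j / fact j \<le> exp (1 / t)"
  proof -
    have "(\<Sum>i\<in>{j}. inverse (fact i) *\<^sub>R (1 / t) ^ i) \<le> (\<Sum>i. inverse (fact i) *\<^sub>R (1 / t) ^ i)"
      using True by (intro sum_le_suminf summable_exp_generic) auto
    then show ?thesis by (simp add: exp_def divide_inverse mult.commute)
  qed
  then show ?thesis
    using True by (simp add: flat_def exp_minus field_simps)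
qed (simp add: flat_def)

text \<open>Exponentials beat powers: \<open>y\<^sup>j / e\<^sup>y\<close> tends to \<open>0\<close> as \<open>y = 1 / t\<close> tends to infinity.\<close>

lemma flat_tendsto_0: "(flat j \<longlongrightarrow> 0) (at 0)"
proof -
  have "((\<lambda>t::real. (inverse t) ^ j / exp (inverse t)) \<longlongrightarrow> 0) (at_right 0)"
    by (rule filterlim_compose[OF tendsto_power_div_exp_0 filterlim_inverse_at_top_right])
  then have "(flat j \<longlongrightarrow> 0) (at_right 0)"
    by (rule Lim_transform_eventually)
       (auto simp: eventually_at_filter flat_def exp_minus field_simps)
  moreover have "(flat j \<longlongrightarrow> 0) (at_left 0)"
    by (rule Lim_transform_eventually[where f = "\<lambda>_. 0"])
       (auto simp: eventually_at_filter flat_def)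
  ultimately show ?thesis by (simp add: filterlim_split_at)
qed

text \<open>The only delicate point is the origin, where the difference quotient of \<open>flat j\<close> is exactly
  \<open>flat (j + 1)\<close>, so that differentiability there reduces to the limit just computed.\<close>

lemma has_field_derivative_flat:
  "(flat j has_field_derivative (flat (j + 2) t - real j * flat (Suc j) t)) (at t)"
proof (cases t "0::real" rule: linorder_cases)
  case less
  have "((\<lambda>_. 0) has_field_derivative 0) (at t)" by simp
  then have "(flat j has_field_derivative 0) (at t)"
    by (rule has_field_derivative_transform_within_open[where S = "{..<0}"])
       (use less in \<open>auto simp: flat_def\<close>)
  then show ?thesis using less by (simp add: flat_def)
next
  case equal
  have "((\<lambda>h. (flat j (0 + h) - flat j 0) / h) \<longlongrightarrow> 0) (at 0)"
    by (rule Lim_transform_eventually[OF flat_tendsto_0[of "Suc j"]])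
       (auto simp: eventually_at_filter flat_def)
  then show ?thesis using equal by (simp add: DERIV_def flat_def)
next
  case greater
  have inv: "((\<lambda>t. 1 / t) has_field_derivative - (1 / t)\<^sup>2) (at t)"
    using greater by (auto intro!: derivative_eq_intros simp: power2_eq_square)
  have "((\<lambda>t. (1 / t) ^ j * exp (- (1 / t))) has_field_derivative
      real j * (- (1 / t)\<^sup>2 * (1 / t) ^ (j - Suc 0)) * exp (- (1 / t))
        + exp (- (1 / t)) * - (- (1 / t)\<^sup>2) * (1 / t) ^ j) (at t)"
    by (rule DERIV_mult DERIV_power DERIV_fun_exp DERIV_minus inv)+
  also have "real j * (- (1 / t)\<^sup>2 * (1 / t) ^ (j - Suc 0)) * exp (- (1 / t))
        + exp (- (1 / t)) * - (- (1 / t)\<^sup>2) * (1 / t) ^ j = flat (j + 2) t - real j * flat (Suc j) t"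
    using greater
    by (cases j) (simp_all add: flat_def power2_eq_square algebra_simps del: power_one_over)
  finally have "((\<lambda>t. (1 / t) ^ j * exp (- (1 / t))) has_field_derivative
      (flat (j + 2) t - real j * flat (Suc j) t)) (at t)" .
  then show ?thesis
    by (rule has_field_derivative_transform_within_open[where S = "{0<..}"])
       (use greater in \<open>auto simp: flat_def\<close>)
qed

lemma isCont_flat: "isCont (flat j) t"
  using has_field_derivative_flat by (rule DERIV_isCont)

lemma continuous_on_flat [continuous_intros]:
  "continuous_on S f \<Longrightarrow> continuous_on S (\<lambda>x. flat j (f x))"
  by (rule continuous_on_compose2[OF continuous_at_imp_continuous_on[of UNIV "flat j"]])
     (auto simp: isCont_flat)

lemma has_derivative_flat_radial:
  "((\<lambda>x. flat j (1 - r\<^sup>2 * (x \<bullet> x))) has_derivative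
    (\<lambda>h. (flat (j + 2) (1 - r\<^sup>2 * (x \<bullet> x)) - real j * flat (Suc j) (1 - r\<^sup>2 * (x \<bullet> x)))
          * (- 2 * r\<^sup>2 * (x \<bullet> h)))) (at (x::'a::euclidean_space))"
proof -
  have "((\<lambda>x. 1 - r\<^sup>2 * (x \<bullet> x)) has_derivative (\<lambda>h. - 2 * r\<^sup>2 * (x \<bullet> h))) (at x)"
    by (auto intro!: derivative_eq_intros simp: inner_commute)
  from DERIV_compose_FDERIV[OF has_field_derivative_flat this]
  show ?thesis by (simp add: mult.commute)
qed

lemma C_k_flat_radial: "C_k k (\<lambda>x::'a::euclidean_space. flat j (1 - r\<^sup>2 * (x \<bullet> x)))"
proof (induction k arbitrary: j)
  case 0
  show ?case by (auto intro!: continuous_intros)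
next
  case (Suc k)
  have "C_k k (\<lambda>x. (flat (j + 2) (1 - r\<^sup>2 * (x \<bullet> x)) + (- real j) * flat (Suc j) (1 - r\<^sup>2 * (x \<bullet> x)))
          * ((- 2 * r\<^sup>2) * (x \<bullet> b)))" for b :: 'a
    by (intro C_k_mult C_k_add C_k_const C_k_inner Suc)
  then show ?case
    by (intro C_k_SucI[OF has_derivative_flat_radial]) simp
qed

text \<open>A plane wave truncated smoothly to the ball of radius \<open>1 / r\<close>. Writing the cutoff as a function of
  \<open>r\<^sup>2 |x|\<^sup>2\<close> keeps it smooth at the origin, and makes it and all its derivatives continuous in \<open>r\<close> up
  to \<open>r = 0\<close>, where it is a constant multiple of the untruncated wave.\<close>

definition cutoff_wave :: "'a::euclidean_space \<Rightarrow> real \<Rightarrow> real \<Rightarrow> 'a \<Rightarrow> real" where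
  "cutoff_wave \<xi> \<theta> r x = flat 0 (1 - r\<^sup>2 * (x \<bullet> x)) * cos (x \<bullet> \<xi> + \<theta>)"

lemma test_function_cutoff_wave:
  assumes "r > 0"
  shows "test_function (cutoff_wave \<xi> \<theta> r)"
proof -
  have "{x. cutoff_wave \<xi> \<theta> r x \<noteq> 0} \<subseteq> cball 0 (1 / r)"
  proof
    fix x assume "x \<in> {x. cutoff_wave \<xi> \<theta> r x \<noteq> 0}"
    then have "(r * norm x)\<^sup>2 < 1\<^sup>2"
      by (auto simp: cutoff_wave_def flat_def power_mult_distrib dot_square_norm split: if_splits)
    then have "r * norm x < 1" by (rule power_less_imp_less_base) simp
    then show "x \<in> cball 0 (1 / r)" using assms by (simp add: field_simps)
  qed
  then have "compact (closure {x. cutoff_wave \<xi> \<theta> r x \<noteq> 0})"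
    by (meson bounded_cball bounded_subset compact_closure)
  moreover have "C_k k (cutoff_wave \<xi> \<theta> r)" for k
    unfolding cutoff_wave_def by (intro C_k_mult C_k_flat_radial C_k_plane_wave)
  ultimately show ?thesis by (simp add: test_function_def)
qed

text \<open>The factors are grouped so that \<open>x \<bullet> b\<close> occurs only as \<open>r * (x \<bullet> b)\<close>, which is at most \<open>1\<close> in absolute value
  on the support of the cutoff, and so that every term carrying a derivative of the cutoff retains a spare factor \<open>r\<close>.
  The first property yields a bound uniform in \<open>r\<close>, the second the limit \<open>r \<rightarrow> 0\<close>.\<close>

lemma laplacian_cutoff_wave:
  fixes \<xi> :: "'a::euclidean_space"
  defines "q \<equiv> \<lambda>r x::'a. 1 - r\<^sup>2 * (x \<bullet> x)"
  shows "laplacian (cutoff_wave \<xi> \<theta> r) x =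
    (\<Sum>b\<in>Basis. (4 * r\<^sup>2 * (r * (x \<bullet> b))\<^sup>2 * (flat 4 (q r x) - 2 * flat 3 (q r x))
        - 2 * r\<^sup>2 * flat 2 (q r x) - (\<xi> \<bullet> b)\<^sup>2 * flat 0 (q r x)) * cos (x \<bullet> \<xi> + \<theta>)
      + 4 * r * (r * (x \<bullet> b)) * (\<xi> \<bullet> b) * flat 2 (q r x) * sin (x \<bullet> \<xi> + \<theta>))"
proof -
  have radial: "((\<lambda>x. flat j (q r x)) has_derivative
      (\<lambda>h. (flat (j + 2) (q r x) - real j * flat (Suc j) (q r x)) * (- 2 * r\<^sup>2 * (x \<bullet> h)))) (at x)"
    for j x unfolding q_def by (rule has_derivative_flat_radial)
  have radial0: "((\<lambda>x. flat 0 (q r x)) has_derivative (\<lambda>h. flat 2 (q r x) * (- 2 * r\<^sup>2 * (x \<bullet> h)))) (at x)"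
    for x using radial[of 0 x] by (simp add: numeral_2_eq_2)
  have radial2: "((\<lambda>x. flat 2 (q r x)) has_derivative
      (\<lambda>h. (flat 4 (q r x) - 2 * flat 3 (q r x)) * (- 2 * r\<^sup>2 * (x \<bullet> h)))) (at x)"
    for x using radial[of 2 x] by simp
  have cos: "((\<lambda>x. cos (x \<bullet> \<xi> + \<theta>)) has_derivative (\<lambda>h. - sin (x \<bullet> \<xi> + \<theta>) * (h \<bullet> \<xi>))) (at x)"
    and sin: "((\<lambda>x. sin (x \<bullet> \<xi> + \<theta>)) has_derivative (\<lambda>h. cos (x \<bullet> \<xi> + \<theta>) * (h \<bullet> \<xi>))) (at x)"
    and inner: "((\<lambda>x. x \<bullet> b) has_derivative (\<lambda>h. h \<bullet> b)) (at x)" for x b :: 'a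
    by (auto intro!: derivative_eq_intros)
  have first: "partial_deriv b (cutoff_wave \<xi> \<theta> r) =
      (\<lambda>x. (- 2 * r\<^sup>2) * (x \<bullet> b) * flat 2 (q r x) * cos (x \<bullet> \<xi> + \<theta>)
         - (\<xi> \<bullet> b) * flat 0 (q r x) * sin (x \<bullet> \<xi> + \<theta>))" for b
  proof
    fix x
    show "partial_deriv b (cutoff_wave \<xi> \<theta> r) x = (- 2 * r\<^sup>2) * (x \<bullet> b) * flat 2 (q r x) * cos (x \<bullet> \<xi> + \<theta>)
         - (\<xi> \<bullet> b) * flat 0 (q r x) * sin (x \<bullet> \<xi> + \<theta>)"
      using partial_deriv_eqI[OF has_derivative_mult[OF radial0 cos], of b x]
      unfolding cutoff_wave_def[abs_def] q_def by (simp add: inner_commute)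
  qed
  have "partial_deriv b (partial_deriv b (cutoff_wave \<xi> \<theta> r)) x =
      (4 * r\<^sup>2 * (r * (x \<bullet> b))\<^sup>2 * (flat 4 (q r x) - 2 * flat 3 (q r x))
        - 2 * r\<^sup>2 * flat 2 (q r x) - (\<xi> \<bullet> b)\<^sup>2 * flat 0 (q r x)) * cos (x \<bullet> \<xi> + \<theta>)
      + 4 * r * (r * (x \<bullet> b)) * (\<xi> \<bullet> b) * flat 2 (q r x) * sin (x \<bullet> \<xi> + \<theta>)"
    if "b \<in> Basis" for b
  proof -
    have "b \<bullet> b = 1" using that by simp
    show ?thesis
      unfolding first
      by (rule trans[OF partial_deriv_eqI[OF has_derivative_diff[OF
            has_derivative_mult[OF has_derivative_mult[OF has_derivative_mult_right[OF inner[of b x]] radial2] cos]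
            has_derivative_mult[OF has_derivative_mult_right[OF radial0] sin]]]],
          simp only: inner_commute[of b \<xi>] \<open>b \<bullet> b = 1\<close>, algebra)
  qed
  then show ?thesis
    unfolding laplacian_def by (intro sum.cong refl)
qed

text \<open>The bound depends neither on \<open>r\<close> nor on \<open>x\<close>, so that a multiple of \<open>|u|\<close> dominates \<open>u\<close> times the
  Laplacians of all the truncated waves. Its constants come from \<open>|flat j| \<le> j!\<close>: the factor \<open>flat 4 - 2 flat 3\<close> is at
  most \<open>24 + 2 * 6 = 36\<close>, and \<open>148 = 4 * 36 + 2 * 2\<close>.\<close>

lemma abs_laplacian_cutoff_wave_le:
  fixes \<xi> x :: "'a::euclidean_space"
  assumes r: "0 \<le> r" "r \<le> 1"
  shows "\<bar>laplacian (cutoff_wave \<xi> \<theta> r) x\<bar> \<le> (\<Sum>b\<in>Basis. 148 + (\<xi> \<bullet> b)\<^sup>2 + 8 * \<bar>\<xi> \<bullet> b\<bar>)"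
proof -
  define q where "q = 1 - r\<^sup>2 * (x \<bullet> x)"
  have flat: "\<bar>flat j q\<bar> \<le> fact j" for j
    using flat_nonneg[of j q] flat_le_fact[of j q] by simp
  have f: "\<bar>flat 0 q\<bar> \<le> 1" "\<bar>flat 2 q\<bar> \<le> 2" "\<bar>flat 3 q\<bar> \<le> 6" "\<bar>flat 4 q\<bar> \<le> 24"
    using flat[of 0] flat[of 2] flat[of 3] flat[of 4] by (simp_all add: fact_numeral)
  have prod_le: "\<bar>y * z\<bar> \<le> C" if "\<bar>y\<bar> \<le> 1" "\<bar>z\<bar> \<le> C" for y z C :: real
    using mult_mono[OF that] that by (simp add: abs_mult)
  have summand: "\<bar>(4 * r\<^sup>2 * (r * (x \<bullet> b))\<^sup>2 * (flat 4 q - 2 * flat 3 q)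
        - 2 * r\<^sup>2 * flat 2 q - (\<xi> \<bullet> b)\<^sup>2 * flat 0 q) * cos (x \<bullet> \<xi> + \<theta>)
      + 4 * r * (r * (x \<bullet> b)) * (\<xi> \<bullet> b) * flat 2 q * sin (x \<bullet> \<xi> + \<theta>)\<bar>
      \<le> 148 + (\<xi> \<bullet> b)\<^sup>2 + 8 * \<bar>\<xi> \<bullet> b\<bar>" if b: "b \<in> Basis" for b
  proof (cases "q > 0")
    case False
    then show ?thesis by (simp add: flat_def)
  next
    case True
    have "(r * norm x)\<^sup>2 \<le> 1\<^sup>2"
      using True by (simp add: q_def power_mult_distrib dot_square_norm)
    then have "r * norm x \<le> 1" by (rule power2_le_imp_le) simp
    moreover have "\<bar>r * (x \<bullet> b)\<bar> \<le> r * norm x"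
      using r Basis_le_norm[OF b, of x] by (simp add: abs_mult mult_left_mono)
    ultimately have y: "\<bar>r * (x \<bullet> b)\<bar> \<le> 1" by simp
    have r1: "\<bar>r\<bar> \<le> 1" using r by simp
    have sq: "\<bar>r\<^sup>2\<bar> \<le> 1" "\<bar>(r * (x \<bullet> b))\<^sup>2\<bar> \<le> 1"
      using r1 y by (simp_all add: abs_square_le_1)
    have "\<bar>r\<^sup>2 * ((r * (x \<bullet> b))\<^sup>2 * (flat 4 q - 2 * flat 3 q))\<bar> \<le> 36"
      by (intro prod_le sq) (use f in linarith)
    moreover have "\<bar>r\<^sup>2 * flat 2 q\<bar> \<le> 2"
      by (intro prod_le sq f)
    moreover have "\<bar>flat 0 q * (\<xi> \<bullet> b)\<^sup>2\<bar> \<le> (\<xi> \<bullet> b)\<^sup>2"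
      by (intro prod_le f) simp
    ultimately have P: "\<bar>4 * (r\<^sup>2 * ((r * (x \<bullet> b))\<^sup>2 * (flat 4 q - 2 * flat 3 q)))
        - 2 * (r\<^sup>2 * flat 2 q) - flat 0 q * (\<xi> \<bullet> b)\<^sup>2\<bar> \<le> 148 + (\<xi> \<bullet> b)\<^sup>2"
      by linarith
    have "\<bar>flat 2 q / 2 * (\<xi> \<bullet> b)\<bar> \<le> \<bar>\<xi> \<bullet> b\<bar>"
      by (intro prod_le) (use f in auto)
    then have "\<bar>r * ((r * (x \<bullet> b)) * (flat 2 q / 2 * (\<xi> \<bullet> b)))\<bar> \<le> \<bar>\<xi> \<bullet> b\<bar>"
      by (rule prod_le[OF r1 prod_le[OF y]])
    then have Q: "\<bar>8 * (r * ((r * (x \<bullet> b)) * (flat 2 q / 2 * (\<xi> \<bullet> b))))\<bar> \<le> 8 * \<bar>\<xi> \<bullet> b\<bar>"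
      by linarith
    have "\<bar>cos (x \<bullet> \<xi> + \<theta>) * (4 * (r\<^sup>2 * ((r * (x \<bullet> b))\<^sup>2 * (flat 4 q - 2 * flat 3 q)))
        - 2 * (r\<^sup>2 * flat 2 q) - flat 0 q * (\<xi> \<bullet> b)\<^sup>2)
        + sin (x \<bullet> \<xi> + \<theta>) * (8 * (r * ((r * (x \<bullet> b)) * (flat 2 q / 2 * (\<xi> \<bullet> b)))))\<bar>
        \<le> (148 + (\<xi> \<bullet> b)\<^sup>2) + 8 * \<bar>\<xi> \<bullet> b\<bar>"
      by (intro order_trans[OF abs_triangle_ineq] add_mono prod_le P Q) simp_all
    also have "cos (x \<bullet> \<xi> + \<theta>) * (4 * (r\<^sup>2 * ((r * (x \<bullet> b))\<^sup>2 * (flat 4 q - 2 * flat 3 q)))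
        - 2 * (r\<^sup>2 * flat 2 q) - flat 0 q * (\<xi> \<bullet> b)\<^sup>2)
        + sin (x \<bullet> \<xi> + \<theta>) * (8 * (r * ((r * (x \<bullet> b)) * (flat 2 q / 2 * (\<xi> \<bullet> b)))))
      = (4 * r\<^sup>2 * (r * (x \<bullet> b))\<^sup>2 * (flat 4 q - 2 * flat 3 q)
        - 2 * r\<^sup>2 * flat 2 q - (\<xi> \<bullet> b)\<^sup>2 * flat 0 q) * cos (x \<bullet> \<xi> + \<theta>)
      + 4 * r * (r * (x \<bullet> b)) * (\<xi> \<bullet> b) * flat 2 q * sin (x \<bullet> \<xi> + \<theta>)"
      by (simp add: mult.assoc mult.left_commute mult.commute)
    finally show ?thesis .
  qed
  show ?thesis
    unfolding laplacian_cutoff_wave q_def[symmetric]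
    by (intro order_trans[OF sum_abs] sum_mono summand)
qed

section \<open>The Fourier transform of an integrable solution\<close>

text \<open>Formally this is the Fourier transform of the equation \<open>- \<Delta>u = \<mu> u\<close>. A plane wave is not a test function, but for
  integrable \<open>u\<close> dominated convergence passes from the truncated waves to the wave itself, whose negative
  Laplacian is \<open>|\<xi>|\<^sup>2\<close> times the wave.\<close>

lemma helmholtz_fourier_supported_on_sphere:
  fixes u :: "'a::euclidean_space \<Rightarrow> real"
  assumes u: "integrable lebesgue u" and weak: "weak_helmholtz \<mu> u"
  shows "(\<xi> \<bullet> \<xi> - \<mu>) * (\<integral>x. u x * cos (x \<bullet> \<xi> + \<theta>) \<partial>lebesgue) = 0"
proof -
  define r where "r k = inverse (real (Suc k))" for k
  have r: "0 < r k" "r k \<le> 1" for k by (auto simp: r_def field_simps)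
  have "r \<longlonglongrightarrow> 0" unfolding r_def by (rule LIMSEQ_inverse_real_of_nat)
  then have at_0: "(\<lambda>k. f (r k)) \<longlonglongrightarrow> f 0" if "continuous_on UNIV f" for f :: "real \<Rightarrow> real"
    using that by (auto intro: continuous_on_tendsto_compose)
  let ?wave = "\<lambda>k. cutoff_wave \<xi> \<theta> (r k)"
  have uM: "u \<in> borel_measurable lebesgue" using u by auto
  have cont: "f \<in> borel_measurable lebesgue" if "continuous_on UNIV f" for f :: "'a \<Rightarrow> real"
    using borel_measurable_continuous_onI[OF that] by (intro measurable_completion) simp
  have tendsto: "(\<lambda>k. \<integral>x. u x * f k x \<partial>lebesgue) \<longlonglongrightarrow> (\<integral>x. u x * F x \<partial>lebesgue)"
    if "\<And>k. continuous_on UNIV (f k)" "continuous_on UNIV F" "\<And>k x. \<bar>f k x\<bar> \<le> B"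
      "\<And>x. (\<lambda>k. f k x) \<longlonglongrightarrow> F x" for f F and B :: real
  proof (rule integral_dominated_convergence[where w = "\<lambda>x. \<bar>u x\<bar> * B"])
    show "integrable lebesgue (\<lambda>x. \<bar>u x\<bar> * B)" using u by simp
    show "AE x in lebesgue. (\<lambda>k. u x * f k x) \<longlonglongrightarrow> u x * F x"
      by (intro always_eventually allI tendsto_mult tendsto_const that)
    show "AE x in lebesgue. norm (u x * f k x) \<le> \<bar>u x\<bar> * B" for k
      by (intro always_eventually allI) (simp add: abs_mult mult_left_mono that)
  qed (intro borel_measurable_times uM cont that)+
  have lim_rhs: "(\<lambda>k. \<integral>x. u x * ?wave k x \<partial>lebesgue) \<longlonglongrightarrow>
      (\<integral>x. u x * (flat 0 1 * cos (x \<bullet> \<xi> + \<theta>)) \<partial>lebesgue)"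
  proof (rule tendsto[where B = 1])
    show "continuous_on UNIV (?wave k)" for k
      unfolding cutoff_wave_def by (intro continuous_intros)
    show "continuous_on UNIV (\<lambda>x. flat 0 1 * cos (x \<bullet> \<xi> + \<theta>))"
      by (intro continuous_intros)
    show "\<bar>?wave k x\<bar> \<le> 1" for k x
      unfolding cutoff_wave_def abs_mult
      using flat_nonneg flat_le_fact[of 0] by (intro mult_le_one) auto
    have "continuous_on UNIV (\<lambda>s. cutoff_wave \<xi> \<theta> s x)" for x
      unfolding cutoff_wave_def by (intro continuous_intros)
    from at_0[OF this] show "(\<lambda>k. ?wave k x) \<longlonglongrightarrow> flat 0 1 * cos (x \<bullet> \<xi> + \<theta>)" for x
      by (simp add: cutoff_wave_def)
  qed
  have lim_lhs: "(\<lambda>k. \<integral>x. u x * (- laplacian (?wave k) x) \<partial>lebesgue) \<longlonglongrightarrow>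
      (\<integral>x. u x * ((\<xi> \<bullet> \<xi>) * (flat 0 1 * cos (x \<bullet> \<xi> + \<theta>))) \<partial>lebesgue)"
  proof (rule tendsto)
    show "continuous_on UNIV (\<lambda>x. - laplacian (?wave k) x)" for k
      unfolding laplacian_cutoff_wave by (intro continuous_intros)
    show "continuous_on UNIV (\<lambda>x. (\<xi> \<bullet> \<xi>) * (flat 0 1 * cos (x \<bullet> \<xi> + \<theta>)))"
      by (intro continuous_intros)
    show "\<bar>- laplacian (?wave k) x\<bar> \<le> (\<Sum>b\<in>Basis. 148 + (\<xi> \<bullet> b)\<^sup>2 + 8 * \<bar>\<xi> \<bullet> b\<bar>)" for k x
      using abs_laplacian_cutoff_wave_le[of "r k"] r[of k] by simp
    have "continuous_on UNIV (\<lambda>s. - laplacian (cutoff_wave \<xi> \<theta> s) x)" for x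
      unfolding laplacian_cutoff_wave by (intro continuous_intros)
    from at_0[OF this] have "(\<lambda>k. - laplacian (?wave k) x) \<longlonglongrightarrow> - laplacian (cutoff_wave \<xi> \<theta> 0) x" for x .
    moreover have "- laplacian (cutoff_wave \<xi> \<theta> 0) x = (\<xi> \<bullet> \<xi>) * (flat 0 1 * cos (x \<bullet> \<xi> + \<theta>))" for x
      unfolding laplacian_cutoff_wave euclidean_inner[of \<xi> \<xi>]
      by (simp add: sum_negf sum_distrib_right power2_eq_square mult.assoc)
    ultimately show "(\<lambda>k. - laplacian (?wave k) x) \<longlonglongrightarrow> (\<xi> \<bullet> \<xi>) * (flat 0 1 * cos (x \<bullet> \<xi> + \<theta>))" for x
      by simp
  qed
  have "(\<integral>x. u x * (- laplacian (?wave k) x) \<partial>lebesgue) = \<mu> * (\<integral>x. u x * ?wave k x \<partial>lebesgue)" for k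
    using weak test_function_cutoff_wave[OF r(1)] unfolding weak_helmholtz_def by blast
  then have "(\<integral>x. u x * ((\<xi> \<bullet> \<xi>) * (flat 0 1 * cos (x \<bullet> \<xi> + \<theta>))) \<partial>lebesgue)
      = \<mu> * (\<integral>x. u x * (flat 0 1 * cos (x \<bullet> \<xi> + \<theta>)) \<partial>lebesgue)"
    using LIMSEQ_unique[OF lim_lhs] tendsto_mult[OF tendsto_const lim_rhs] by simp
  then have "((\<xi> \<bullet> \<xi>) * flat 0 1) * (\<integral>x. u x * cos (x \<bullet> \<xi> + \<theta>) \<partial>lebesgue)
      = (\<mu> * flat 0 1) * (\<integral>x. u x * cos (x \<bullet> \<xi> + \<theta>) \<partial>lebesgue)"
    by (simp only: mult.assoc mult.left_commute[of "u _"] integral_mult_right_zero)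
  moreover have "flat 0 1 \<noteq> 0" by (simp add: flat_def)
  ultimately show ?thesis by (simp add: left_diff_distrib)
qed

text \<open>The Fourier transform of an integrable function is continuous, and a sphere has empty interior: a frequency \<open>\<xi>\<close>
  with \<open>|\<xi>|\<^sup>2 = \<mu>\<close> is a limit of frequencies off the sphere, at which the transform is already known to vanish.\<close>

lemma helmholtz_fourier_zero:
  fixes u :: "'a::euclidean_space \<Rightarrow> real"
  assumes u: "integrable lebesgue u" and weak: "weak_helmholtz \<mu> u"
  shows "(\<integral>x. u x * cos (x \<bullet> \<xi> + \<theta>) \<partial>lebesgue) = 0"
proof (cases "\<xi> \<bullet> \<xi> = \<mu>")
  case False
  then show ?thesis
    using helmholtz_fourier_supported_on_sphere[OF u weak, of \<xi> \<theta>] by simp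
next
  case True
  obtain e :: 'a where e: "e \<in> Basis" using nonempty_Basis by blast
  \<comment> \<open>Moving radially outwards leaves the sphere at once; at the origin any direction will do.\<close>
  define v where "v = (if \<xi> = 0 then e else \<xi>)"
  have v: "0 \<le> v \<bullet> \<xi>" "0 < v \<bullet> v" using e by (auto simp: v_def)
  define r where "r k = inverse (real (Suc k))" for k
  have r: "0 < r k" for k by (simp add: r_def)
  have "r \<longlonglongrightarrow> 0" unfolding r_def by (rule LIMSEQ_inverse_real_of_nat)
  have "(\<xi> + r k *\<^sub>R v) \<bullet> (\<xi> + r k *\<^sub>R v) = \<mu> + (2 * r k * (v \<bullet> \<xi>) + r k * r k * (v \<bullet> v))" for k
    using True by (simp add: inner_simps inner_commute algebra_simps)
  moreover have "0 < 2 * r k * (v \<bullet> \<xi>) + r k * r k * (v \<bullet> v)" for k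
    using r[of k] v by (intro add_nonneg_pos mult_nonneg_nonneg mult_pos_pos) auto
  ultimately have off: "(\<xi> + r k *\<^sub>R v) \<bullet> (\<xi> + r k *\<^sub>R v) - \<mu> \<noteq> 0" for k
    by (metis add_diff_cancel_left' less_irrefl)
  have zero: "(\<integral>x. u x * cos (x \<bullet> (\<xi> + r k *\<^sub>R v) + \<theta>) \<partial>lebesgue) = 0" for k
    using helmholtz_fourier_supported_on_sphere[OF u weak, of "\<xi> + r k *\<^sub>R v" \<theta>] off[of k] by simp
  have uM: "u \<in> borel_measurable lebesgue" using u by auto
  have cM: "(\<lambda>x. cos (x \<bullet> \<eta> + \<theta>)) \<in> borel_measurable lebesgue" for \<eta> :: 'a
    by (intro measurable_completion) simp
  have "(\<lambda>k. \<integral>x. u x * cos (x \<bullet> (\<xi> + r k *\<^sub>R v) + \<theta>) \<partial>lebesgue) \<longlonglongrightarrow>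
      (\<integral>x. u x * cos (x \<bullet> \<xi> + \<theta>) \<partial>lebesgue)"
  proof (rule integral_dominated_convergence[where w = "\<lambda>x. \<bar>u x\<bar>"])
    show "integrable lebesgue (\<lambda>x. \<bar>u x\<bar>)" using u by simp
    have "(\<lambda>k. x \<bullet> (\<xi> + r k *\<^sub>R v) + \<theta>) \<longlonglongrightarrow> x \<bullet> (\<xi> + 0 *\<^sub>R v) + \<theta>" for x
      by (intro tendsto_intros \<open>r \<longlonglongrightarrow> 0\<close>)
    then show "AE x in lebesgue. (\<lambda>k. u x * cos (x \<bullet> (\<xi> + r k *\<^sub>R v) + \<theta>)) \<longlonglongrightarrow> u x * cos (x \<bullet> \<xi> + \<theta>)"
      by (intro always_eventually allI tendsto_mult tendsto_const tendsto_cos) simp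
    show "AE x in lebesgue. norm (u x * cos (x \<bullet> (\<xi> + r k *\<^sub>R v) + \<theta>)) \<le> \<bar>u x\<bar>" for k
      by (intro always_eventually allI) (simp add: abs_mult mult_left_le)
  qed (intro borel_measurable_times uM cM)+
  then show ?thesis by (simp add: zero LIMSEQ_const_iff)
qed

section \<open>Uniqueness of the Fourier transform\<close>

text \<open>The one-dimensional uniqueness theorem for characteristic functions, in a form for signed densities. The positive and
  negative parts of \<open>g\<close> have equal mass by the case \<open>t = 0\<close>, so (unless both are zero) both can be normalised to probability
  densities; the laws of \<open>X\<close> under these have the same characteristic function and are therefore equal.\<close>

lemma zero_fourier_imp_zero_mean_on_preimage:
  fixes g X :: "'b \<Rightarrow> real"
  assumes g: "integrable M g" and X[measurable]: "X \<in> borel_measurable M"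
    and zero: "\<And>t \<theta>. (\<integral>x. g x * cos (t * X x + \<theta>) \<partial>M) = 0"
    and A[measurable]: "A \<in> sets borel"
  shows "(\<integral>x. g x * indicator A (X x) \<partial>M) = 0"
proof -
  have [measurable]: "g \<in> borel_measurable M" using g by auto
  define p where "p = (\<lambda>x. max 0 (g x))"
  define n where "n = (\<lambda>x. max 0 (- g x))"
  have g_eq: "g x = p x - n x" for x by (auto simp: p_def n_def)
  have [measurable]: "p \<in> borel_measurable M" "n \<in> borel_measurable M"
    by (auto simp: p_def n_def)
  have nonneg: "0 \<le> p x" "0 \<le> n x" for x by (auto simp: p_def n_def)
  have int: "integrable M p" "integrable M n"
    using g by (auto simp: p_def n_def)
  have mult_int: "integrable M (\<lambda>x. h x *\<^sub>R f x)"
    if "integrable M h" "f \<in> borel_measurable M" "\<And>x. norm (f x) \<le> 1"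
    for h :: "'b \<Rightarrow> real" and f :: "'b \<Rightarrow> 'c::{banach, second_countable_topology}"
    by (rule Bochner_Integration.integrable_bound[OF that(1)])
       (use that in \<open>auto intro!: mult_left_le\<close>)
  \<comment> \<open>The common mass of the two parts, by which they are normalised.\<close>
  define m where "m = (\<integral>x. p x \<partial>M)"
  have "(\<integral>x. g x \<partial>M) = 0" using zero[of 0 0] by simp
  then have m': "m = (\<integral>x. n x \<partial>M)" by (simp add: g_eq int m_def)
  show ?thesis
  proof (cases "m = 0")
    case True
    have "AE x in M. p x = 0" "AE x in M. n x = 0"
      using True m' nonneg integral_nonneg_eq_0_iff_AE[OF int(1)]
        integral_nonneg_eq_0_iff_AE[OF int(2)] by (auto simp: m_def)
    then have "AE x in M. g x * indicator A (X x) = 0"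
      by eventually_elim (simp add: g_eq)
    then show ?thesis by (rule integral_eq_zero_AE)
  next
    case False
    moreover have "0 \<le> m" unfolding m_def by (intro Bochner_Integration.integral_nonneg) (rule nonneg)
    ultimately have m: "m > 0" by simp
    define law where "law = (\<lambda>h. distr (density M (\<lambda>x. ennreal (h x / m))) borel X)"
    have integral_law: "(\<integral>y. f y \<partial>law h) = (\<integral>x. (h x / m) *\<^sub>R f (X x) \<partial>M)"
      if [measurable]: "h \<in> borel_measurable M" "f \<in> borel_measurable borel" and "\<And>x. 0 \<le> h x"
      for h and f :: "real \<Rightarrow> 'c::{banach, second_countable_topology}"
    proof -
      have "(\<integral>y. f y \<partial>law h) = (\<integral>x. f (X x) \<partial>density M (\<lambda>x. ennreal (h x / m)))"
        unfolding law_def by (rule integral_distr) simp_all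
      also have "\<dots> = (\<integral>x. (h x / m) *\<^sub>R f (X x) \<partial>M)"
        by (rule integral_density) (use that(3) m in simp_all)
      finally show ?thesis .
    qed
    have law: "real_distribution (law h)"
      if [measurable]: "integrable M h" and nn: "\<And>x. 0 \<le> h x" and "(\<integral>x. h x \<partial>M) = m" for h
    proof -
      have [measurable]: "h \<in> borel_measurable M" using that by auto
      have "emeasure (density M (\<lambda>x. ennreal (h x / m))) (space M) = (\<integral>\<^sup>+x. ennreal (h x / m) \<partial>M)"
        by (subst emeasure_density) (auto intro!: nn_integral_cong)
      also have "\<dots> = ennreal (\<integral>x. h x / m \<partial>M)"
        by (rule nn_integral_eq_integral) (use that m in auto)
      also have "\<dots> = 1" using that m by simp
      finally have "prob_space (density M (\<lambda>x. ennreal (h x / m)))"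
        by (intro prob_spaceI) simp
      then show ?thesis
        unfolding law_def by (intro prob_space.real_distribution_distr) simp_all
    qed
    have "char (law p) t = char (law n) t" for t
    proof -
      have iexp: "norm (iexp y) \<le> 1" for y by (simp only: norm_exp_i_times)
      have int_exp: "integrable M (\<lambda>x. (h x / m) *\<^sub>R iexp (t * X x))" if "integrable M h" for h
        by (rule mult_int) (use that iexp in auto)
      have "(\<integral>x. (g x / m) *\<^sub>R iexp (t * X x) \<partial>M) = 0"
      proof (rule complex_eqI)
        have "Re (\<integral>x. (g x / m) *\<^sub>R iexp (t * X x) \<partial>M) = (\<integral>x. g x * cos (t * X x + 0) / m \<partial>M)"
          by (subst integral_Re[symmetric, OF int_exp[OF g]]) (simp add: Re_exp)
        also have "\<dots> = 0" using zero[of t 0] by simp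
        finally show "Re (\<integral>x. (g x / m) *\<^sub>R iexp (t * X x) \<partial>M) = Re 0" by simp
        have "Im (\<integral>x. (g x / m) *\<^sub>R iexp (t * X x) \<partial>M) = (\<integral>x. g x * cos (t * X x + (- pi / 2)) / m \<partial>M)"
          by (subst integral_Im[symmetric, OF int_exp[OF g]])
             (simp add: Im_exp cos_diff)
        also have "\<dots> = 0" using zero[of t "- pi / 2"] by simp
        finally show "Im (\<integral>x. (g x / m) *\<^sub>R iexp (t * X x) \<partial>M) = Im 0" by simp
      qed
      then have "(\<integral>x. (p x / m) *\<^sub>R iexp (t * X x) \<partial>M) - (\<integral>x. (n x / m) *\<^sub>R iexp (t * X x) \<partial>M) = 0"
        using int_exp[OF int(1)] int_exp[OF int(2)]
        by (subst Bochner_Integration.integral_diff[symmetric])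
           (auto simp: g_eq diff_divide_distrib scaleR_diff_left)
      then show ?thesis
        unfolding char_def using nonneg by (subst (1 2) integral_law) auto
    qed
    then have "law p = law n"
      using int nonneg m_def m' by (intro Levy_uniqueness law ext) auto
    then have "(\<integral>y. indicator A y \<partial>law p) = (\<integral>y. indicator A y \<partial>law n :: real)" by simp
    then have "(\<integral>x. (p x / m) *\<^sub>R indicator A (X x) \<partial>M) = (\<integral>x. (n x / m) *\<^sub>R indicator A (X x) \<partial>M :: real)"
      using nonneg by (subst (asm) (1 2) integral_law) auto
    then have "(\<integral>x. p x * indicator A (X x) \<partial>M) = (\<integral>x. n x * indicator A (X x) \<partial>M)"
      using m by simp
    moreover have "integrable M (\<lambda>x. p x *\<^sub>R (indicator A (X x) :: real))"
        "integrable M (\<lambda>x. n x *\<^sub>R (indicator A (X x) :: real))"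
      by (intro mult_int int; simp add: indicator_def)+
    ultimately show ?thesis by (simp add: g_eq left_diff_distrib)
  qed
qed

text \<open>The uniqueness theorem in several dimensions follows from the one-dimensional one by turning oscillating factors into
  indicators one coordinate at a time. The frequency \<open>\<xi>\<close> stays arbitrary during the induction: a product of two cosines is a sum
  of cosines, so testing in the direction \<open>b\<close> only shifts \<open>\<xi>\<close> by multiples of \<open>b\<close>.\<close>

lemma zero_fourier_imp_zero_on_boxes:
  fixes u :: "'a::euclidean_space \<Rightarrow> real"
  assumes u: "integrable lborel u"
    and zero: "\<And>\<xi> \<theta>. (\<integral>x. u x * cos (x \<bullet> \<xi> + \<theta>) \<partial>lborel) = 0"
  shows "(\<integral>x. u x * indicator (box l r) x \<partial>lborel) = 0"
proof -
  have [measurable]: "u \<in> borel_measurable borel" using u by auto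
  define slab where "slab = (\<lambda>J x. \<Prod>b\<in>J. indicator {l \<bullet> b<..<r \<bullet> b} (x \<bullet> b) :: real)"
  have [measurable]: "slab J \<in> borel_measurable borel" for J
    unfolding slab_def by measurable
  have slab: "\<bar>slab J x\<bar> \<le> 1" for J x
    unfolding slab_def abs_prod by (intro prod_le_1) (auto simp: indicator_def)
  have int: "integrable lborel (\<lambda>x. u x * slab J x * cos (x \<bullet> \<xi> + \<theta>))" for J \<xi> \<theta>
    by (rule Bochner_Integration.integrable_bound[OF u])
       (auto simp: abs_mult mult.assoc intro!: mult_left_le mult_le_one slab)
  have "(\<integral>x. u x * slab J x * cos (x \<bullet> \<xi> + \<theta>) \<partial>lborel) = 0" if "finite J" for J \<xi> \<theta>
    using that
  proof (induction J arbitrary: \<xi> \<theta>)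
    case empty
    then show ?case using zero by (simp add: slab_def)
  next
    case (insert b J)
    have "(\<integral>x. (u x * slab J x * cos (x \<bullet> \<xi> + \<theta>)) * indicator {l \<bullet> b<..<r \<bullet> b} (x \<bullet> b) \<partial>lborel) = 0"
    proof (rule zero_fourier_imp_zero_mean_on_preimage[OF int])
      fix t \<theta>'
      have "(\<integral>x. (u x * slab J x * cos (x \<bullet> \<xi> + \<theta>)) * cos (t * (x \<bullet> b) + \<theta>') \<partial>lborel) =
        (\<integral>x. (u x * slab J x * cos (x \<bullet> (\<xi> - t *\<^sub>R b) + (\<theta> - \<theta>'))
             + u x * slab J x * cos (x \<bullet> (\<xi> + t *\<^sub>R b) + (\<theta> + \<theta>'))) / 2 \<partial>lborel)"
      proof (rule Bochner_Integration.integral_cong[OF refl])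
        fix x
        have "x \<bullet> \<xi> + \<theta> - (t * (x \<bullet> b) + \<theta>') = x \<bullet> (\<xi> - t *\<^sub>R b) + (\<theta> - \<theta>')"
          "x \<bullet> \<xi> + \<theta> + (t * (x \<bullet> b) + \<theta>') = x \<bullet> (\<xi> + t *\<^sub>R b) + (\<theta> + \<theta>')"
          by (simp_all add: inner_diff_right inner_add_right)
        then show "u x * slab J x * cos (x \<bullet> \<xi> + \<theta>) * cos (t * (x \<bullet> b) + \<theta>') =
          (u x * slab J x * cos (x \<bullet> (\<xi> - t *\<^sub>R b) + (\<theta> - \<theta>'))
             + u x * slab J x * cos (x \<bullet> (\<xi> + t *\<^sub>R b) + (\<theta> + \<theta>'))) / 2"
          by (simp only: mult.assoc cos_times_cos) (simp add: distrib_left)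
      qed
      also have "\<dots> = 0"
        using insert.IH by (simp add: Bochner_Integration.integral_add[OF int int])
      finally show "(\<integral>x. (u x * slab J x * cos (x \<bullet> \<xi> + \<theta>)) * cos (t * (x \<bullet> b) + \<theta>') \<partial>lborel) = 0" .
    qed auto
    then show ?case using insert.hyps by (simp add: slab_def mult_ac)
  qed
  from this[of Basis 0 0] have "(\<integral>x. u x * slab Basis x \<partial>lborel) = 0" by simp
  moreover have "slab Basis x = indicator (box l r) x" for x
    by (auto simp: slab_def box_def indicator_def prod_zero_iff)
  ultimately show ?thesis by simp
qed

text \<open>The positive and negative parts of \<open>u\<close> are densities of two finite measures which agree on boxes, an
  intersection-stable generator of the Borel sets; equal measures have equal densities.\<close>

lemma zero_on_boxes_imp_AE_zero:
  fixes u :: "'a::euclidean_space \<Rightarrow> real"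
  assumes u: "integrable lborel u"
    and zero: "\<And>l r. (\<integral>x. u x * indicator (box l r) x \<partial>lborel) = 0"
  shows "AE x in lborel. u x = 0"
proof -
  have [measurable]: "u \<in> borel_measurable borel" using u by auto
  have em: "emeasure (density lborel (\<lambda>x. ennreal (h x))) (box l r) =
      ennreal (\<integral>x. max 0 (h x) * indicator (box l r) x \<partial>lborel)"
    and int: "integrable lborel (\<lambda>x. max 0 (h x) * indicator (box l r) x)"
    if h: "integrable lborel h" for h :: "'a \<Rightarrow> real" and l r
  proof -
    have [measurable]: "h \<in> borel_measurable borel" using h by auto
    show int: "integrable lborel (\<lambda>x. max 0 (h x) * indicator (box l r) x)"
      by (rule Bochner_Integration.integrable_bound[OF h]) (auto simp: indicator_def)
    have "emeasure (density lborel (\<lambda>x. ennreal (h x))) (box l r) =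
        (\<integral>\<^sup>+x. ennreal (max 0 (h x) * indicator (box l r) x) \<partial>lborel)"
      by (subst emeasure_density) (auto intro!: nn_integral_cong simp: indicator_def max_def ennreal_neg)
    also have "\<dots> = ennreal (\<integral>x. max 0 (h x) * indicator (box l r) x \<partial>lborel)"
      by (rule nn_integral_eq_integral[OF int]) auto
    finally show "emeasure (density lborel (\<lambda>x. ennreal (h x))) (box l r) =
      ennreal (\<integral>x. max 0 (h x) * indicator (box l r) x \<partial>lborel)" .
  qed
  have "density lborel (\<lambda>x. ennreal (u x)) = density lborel (\<lambda>x. ennreal (- u x))"
  proof (rule measure_eqI_generator_eq)
    let ?E = "range (\<lambda>(a, b). box a b :: 'a set)"
    show "Int_stable ?E" by (auto simp: Int_stable_def box_Int_box)
    show "?E \<subseteq> Pow UNIV"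
      "sets (density lborel (\<lambda>x. ennreal (u x))) = sigma_sets UNIV ?E"
      "sets (density lborel (\<lambda>x. ennreal (- u x))) = sigma_sets UNIV ?E"
      by (simp_all add: borel_eq_box)
    let ?A = "\<lambda>n::nat. box (- (real n *\<^sub>R One)) (real n *\<^sub>R One) :: 'a set"
    show "range ?A \<subseteq> ?E" "(\<Union>i. ?A i) = UNIV"
      unfolding UN_box_eq_UNIV by auto
    show "emeasure (density lborel (\<lambda>x. ennreal (u x))) (?A i) \<noteq> \<infinity>" for i
      by (simp add: em u)
    fix X assume "X \<in> ?E"
    then obtain l r where X: "X = box l r" by auto
    have u': "integrable lborel (\<lambda>x. - u x)" using u by simp
    have "(\<integral>x. max 0 (u x) * indicator (box l r) x \<partial>lborel)
        - (\<integral>x. max 0 (- u x) * indicator (box l r) x \<partial>lborel)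
      = (\<integral>x. u x * indicator (box l r) x \<partial>lborel)"
      by (subst Bochner_Integration.integral_diff[symmetric, OF int[OF u] int[OF u']])
         (auto intro!: Bochner_Integration.integral_cong simp: indicator_def)
    then show "emeasure (density lborel (\<lambda>x. ennreal (u x))) X =
        emeasure (density lborel (\<lambda>x. ennreal (- u x))) X"
      unfolding X em[OF u] em[OF u'] using zero by simp
  qed
  then have "AE x in lborel. ennreal (u x) = ennreal (- u x)"
    by (intro sigma_finite_measure.density_unique[OF sigma_finite_lborel]) auto
  then show ?thesis
    by eventually_elim (metis ennreal_eq_0_iff ennreal_neg linear neg_le_0_iff_le order_antisym)
qed

text \<open>Replacing \<open>u\<close> by a Borel representative reduces the Lebesgue measurable case to the Borel case.\<close>

lemma zero_fourier_imp_AE_zero: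
  fixes u :: "'a::euclidean_space \<Rightarrow> real"
  assumes u: "integrable lebesgue u"
    and zero: "\<And>\<xi> \<theta>. (\<integral>x. u x * cos (x \<bullet> \<xi> + \<theta>) \<partial>lebesgue) = 0"
  shows "AE x in lebesgue. u x = 0"
proof -
  obtain g where [measurable]: "g \<in> borel_measurable lborel" and ug: "AE x in lborel. u x = g x"
    using completion_ex_borel_measurable_real[of u lborel] u by auto
  have gM: "g \<in> borel_measurable lebesgue" and uM: "u \<in> borel_measurable lebesgue"
    using u by (auto intro: measurable_completion)
  have ug': "AE x in lebesgue. u x = g x" using ug by (rule AE_completion)
  have "integrable lebesgue g"
    using integrable_cong_AE[OF uM gM ug'] u by simp
  then have g: "integrable lborel g" by (simp add: integrable_completion)
  have "(\<integral>x. g x * cos (x \<bullet> \<xi> + \<theta>) \<partial>lborel) = 0" for \<xi> \<theta>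
  proof -
    have cM: "(\<lambda>x. cos (x \<bullet> \<xi> + \<theta>)) \<in> borel_measurable lebesgue"
      by (intro measurable_completion) simp
    have "(\<integral>x. g x * cos (x \<bullet> \<xi> + \<theta>) \<partial>lborel) = (\<integral>x. g x * cos (x \<bullet> \<xi> + \<theta>) \<partial>lebesgue)"
      by (rule integral_completion[symmetric]) simp
    also have "\<dots> = (\<integral>x. u x * cos (x \<bullet> \<xi> + \<theta>) \<partial>lebesgue)"
      using ug' by (intro integral_cong_AE borel_measurable_times gM uM cM) (auto elim: eventually_mono)
    finally show ?thesis using zero by simp
  qed
  then have "AE x in lborel. g x = 0"
    using g by (intro zero_on_boxes_imp_AE_zero zero_fourier_imp_zero_on_boxes)
  with ug have "AE x in lborel. u x = 0" by eventually_elim simp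
  then show ?thesis by (rule AE_completion)
qed

section \<open>Integrability from decay of the tails\<close>

text \<open>A form of Young's inequality that does the work of Cauchy-Schwarz below: it remains
  pointwise, so it can be summed over annuli before anything is known to be integrable.\<close>

lemma abs_le_weighted_square:
  fixes a t :: real
  assumes "a > 0"
  shows "\<bar>t\<bar> \<le> a * t\<^sup>2 + inverse a"
proof (cases "a * \<bar>t\<bar> \<le> 1")
  case True
  then have "\<bar>t\<bar> \<le> inverse a" using assms by (simp add: field_simps)
  moreover have "0 \<le> a * t\<^sup>2" using assms by simp
  ultimately show ?thesis by linarith
next
  case False
  then have "1 * \<bar>t\<bar> \<le> (a * \<bar>t\<bar>) * \<bar>t\<bar>" by (intro mult_right_mono) auto
  then have "\<bar>t\<bar> \<le> a * t\<^sup>2" by (simp add: power2_eq_square mult.assoc)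
  moreover have "0 < inverse a" using assms by simp
  ultimately show ?thesis by linarith
qed

text \<open>On the annulus \<open>\<rho> < |x| \<le> 2\<rho>\<close> the elementary inequality above, with weight \<open>\<rho>\<^sup>n\<^sup>+\<^sup>1\<close>, bounds the integral of \<open>|u|\<close> by
  \<open>\<rho>\<^sup>n\<^sup>+\<^sup>1\<close> times the \<open>L\<^sup>2\<close> tail plus \<open>\<rho>\<^sup>-\<^sup>n\<^sup>-\<^sup>1\<close> times a volume of order \<open>\<rho>\<^sup>n\<close>. The exponent \<open>n + 2\<close> in the
  hypothesis makes both contributions of order \<open>1 / \<rho>\<close>, which is summable over dyadic radii.\<close>

lemma integrable_of_L2_tail_decay:
  fixes u :: "'a::euclidean_space \<Rightarrow> real" and C :: ennreal
  assumes u: "u \<in> L2_loc" and C: "C < \<infinity>"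
    and decay: "eventually (\<lambda>r. ennreal (r powr real (DIM('a) + 2)) * L2_tail u r \<le> C) at_top"
  shows "integrable lebesgue u"
proof -
  let ?n = "DIM('a)"
  have uM[measurable]: "u \<in> borel_measurable lebesgue" using u by (simp add: L2_loc_def)
  have sets[measurable]: "cball (0::'a) R \<in> sets lebesgue" "{x::'a. norm x > R} \<in> sets lebesgue" for R
  proof -
    have "open {x::'a. norm x > R}" by (intro open_Collect_less continuous_intros)
    then show "{x::'a. norm x > R} \<in> sets lebesgue" by (intro sets_completionI_sets) simp
  qed simp
  obtain R where R: "\<And>r. r \<ge> R \<Longrightarrow> ennreal (r powr real (?n + 2)) * L2_tail u r \<le> C"
    using decay by (auto simp: eventually_at_top_linorder)
  obtain K where K: "R < 2 ^ K" using real_arch_pow[of 2 R] by auto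
  define \<rho> :: "nat \<Rightarrow> real" where "\<rho> k = 2 ^ (K + k)" for k
  have \<rho>: "0 < \<rho> k" "R \<le> \<rho> k" for k
  proof -
    have "(2::real) ^ K \<le> \<rho> k" unfolding \<rho>_def by (intro power_increasing) auto
    then show "R \<le> \<rho> k" using K by simp
  qed (simp add: \<rho>_def)
  \<comment> \<open>A majorant of \<open>|u|\<close>: \<open>inner\<close> handles the central ball, \<open>far k\<close> and \<open>near k\<close> the \<open>k\<close>-th dyadic annulus. Its
    summands live on the larger sets \<open>|x| > \<rho> k\<close> and \<open>|x| \<le> 2 \<rho> k\<close>, whose integrals are directly
    an \<open>L\<^sup>2\<close> tail and a volume of a ball.\<close>
  define inner where "inner x = ennreal ((\<bar>u x\<bar>\<^sup>2 + 1) * indicator (cball 0 (2 ^ K)) x)" for x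
  define far where "far k x = ennreal (\<rho> k ^ (?n + 1)) * (ennreal (\<bar>u x\<bar>\<^sup>2) * indicator {x. norm x > \<rho> k} x)" for k x
  define near where "near k x = ennreal (inverse (\<rho> k ^ (?n + 1))) * indicator (cball 0 (2 * \<rho> k)) x" for k and x :: 'a
  have [measurable]: "inner \<in> borel_measurable lebesgue" "far k \<in> borel_measurable lebesgue"
    "near k \<in> borel_measurable lebesgue" for k
    unfolding inner_def[abs_def] far_def[abs_def] near_def[abs_def] by measurable
  have pointwise: "ennreal \<bar>u x\<bar> \<le> inner x + (\<Sum>k. far k x + near k x)" for x
  proof (cases "norm x \<le> 2 ^ K")
    case True
    have "\<bar>u x\<bar> \<le> \<bar>u x\<bar>\<^sup>2 + 1" using abs_le_weighted_square[of 1 "u x"] by simp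
    from ennreal_leI[OF this] have "ennreal \<bar>u x\<bar> \<le> inner x"
      using True by (simp add: inner_def)
    then show ?thesis by (rule order_trans) simp
  next
    case False
    obtain k where k: "\<rho> k < norm x" "norm x \<le> 2 * \<rho> k"
    proof -
      \<comment> \<open>The first dyadic radius that reaches \<open>x\<close> is the outer radius of its annulus.\<close>
      obtain m where "norm x \<le> 2 ^ m" using real_arch_pow[of 2 "norm x"] by (auto intro: less_imp_le)
      then have ex: "norm x \<le> 2 ^ (LEAST m. norm x \<le> 2 ^ m)" by (rule LeastI)
      let ?m = "LEAST m. norm x \<le> 2 ^ m"
      have "K < ?m"
      proof (rule ccontr)
        assume "\<not> K < ?m"
        then have "(2::real) ^ ?m \<le> 2 ^ K" by (intro power_increasing) auto
        with ex False show False by simp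
      qed
      then obtain k where m: "?m = Suc (K + k)" using less_imp_Suc_add by auto
      have "\<not> norm x \<le> 2 ^ (K + k)" using not_less_Least[of "K + k" "\<lambda>m. norm x \<le> 2 ^ m"] m by simp
      with ex that[of k] show thesis unfolding m by (simp add: \<rho>_def)
    qed
    have "ennreal \<bar>u x\<bar> \<le> ennreal (\<rho> k ^ (?n + 1) * \<bar>u x\<bar>\<^sup>2 + inverse (\<rho> k ^ (?n + 1)))"
      using abs_le_weighted_square[of "\<rho> k ^ (?n + 1)" "u x"] \<rho>(1)[of k] by (intro ennreal_leI) simp
    also have "\<dots> = far k x + near k x"
      using k \<rho>(1)[of k] by (simp add: far_def near_def ennreal_plus ennreal_mult)
    also have "\<dots> \<le> (\<Sum>k. far k x + near k x)"
      using sum_le_suminf[of "\<lambda>k. far k x + near k x" "{k}"] by simp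
    finally show ?thesis by (rule order_trans) simp
  qed
  have "(\<integral>\<^sup>+x. inner x \<partial>lebesgue) < \<infinity>"
  proof -
    have "set_integrable lebesgue (cball 0 (2 ^ K)) (\<lambda>x. \<bar>u x\<bar>\<^sup>2)"
      using u by (simp add: L2_loc_def)
    then have "integrable lebesgue (\<lambda>x. \<bar>u x\<bar>\<^sup>2 * indicator (cball 0 (2 ^ K)) x)"
      by (simp add: set_integrable_def mult.commute)
    moreover have "integrable lebesgue (indicator (cball (0::'a) (2 ^ K)) :: 'a \<Rightarrow> real)"
      by (intro integrable_real_indicator sets) (simp add: emeasure_bounded_finite[simplified])
    ultimately have "integrable lebesgue (\<lambda>x. (\<bar>u x\<bar>\<^sup>2 + 1) * indicator (cball 0 (2 ^ K)) x)"
      by (simp add: distrib_right)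
    then show ?thesis
      unfolding inner_def by (subst nn_integral_eq_integral) auto
  qed
  moreover have "(\<integral>\<^sup>+x. (\<Sum>k. far k x + near k x) \<partial>lebesgue) < \<infinity>"
  proof -
    define V where "V = unit_ball_vol (real ?n) * 2 ^ ?n"
    have V: "0 \<le> V" by (simp add: V_def)
    have far: "(\<integral>\<^sup>+x. far k x \<partial>lebesgue) \<le> ennreal (inverse (\<rho> k)) * C" for k
    proof -
      have "(\<integral>\<^sup>+x. far k x \<partial>lebesgue) = ennreal (\<rho> k ^ (?n + 1)) * L2_tail u (\<rho> k)"
        unfolding far_def L2_tail_def by (rule nn_integral_cmult) measurable
      also have "\<rho> k ^ (?n + 1) = inverse (\<rho> k) * \<rho> k powr real (?n + 2)"
        using \<rho>(1)[of k] by (subst powr_realpow) (auto simp: field_simps)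
      also have "ennreal (inverse (\<rho> k) * \<rho> k powr real (?n + 2)) * L2_tail u (\<rho> k)
          = ennreal (inverse (\<rho> k)) * (ennreal (\<rho> k powr real (?n + 2)) * L2_tail u (\<rho> k))"
        using \<rho>(1)[of k] by (subst ennreal_mult) (auto simp: mult.assoc)
      also have "\<dots> \<le> ennreal (inverse (\<rho> k)) * C"
        by (intro mult_left_mono R \<rho>) simp
      finally show ?thesis .
    qed
    have near: "(\<integral>\<^sup>+x. near k x \<partial>lebesgue) = ennreal (inverse (\<rho> k)) * ennreal V" for k
    proof -
      have "(\<integral>\<^sup>+x. near k x \<partial>lebesgue) = ennreal (inverse (\<rho> k ^ (?n + 1))) * emeasure lebesgue (cball (0::'a) (2 * \<rho> k))"
        unfolding near_def by (rule nn_integral_cmult_indicator) simp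
      also have "emeasure lebesgue (cball (0::'a) (2 * \<rho> k)) = ennreal (unit_ball_vol (real ?n) * (2 * \<rho> k) ^ ?n)"
        using \<rho>(1)[of k] by (simp add: emeasure_cball)
      also have "ennreal (inverse (\<rho> k ^ (?n + 1))) * \<dots> = ennreal (inverse (\<rho> k ^ (?n + 1)) * (unit_ball_vol (real ?n) * (2 * \<rho> k) ^ ?n))"
        using \<rho>(1)[of k] by (subst ennreal_mult) auto
      also have "inverse (\<rho> k ^ (?n + 1)) * (unit_ball_vol (real ?n) * (2 * \<rho> k) ^ ?n) = inverse (\<rho> k) * V"
        using \<rho>(1)[of k] by (simp add: V_def power_mult_distrib field_simps)
      also have "ennreal \<dots> = ennreal (inverse (\<rho> k)) * ennreal V"
        using \<rho>(1)[of k] V by (subst ennreal_mult) auto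
      finally show ?thesis .
    qed
    have "(\<integral>\<^sup>+x. (\<Sum>k. far k x + near k x) \<partial>lebesgue) = (\<Sum>k. (\<integral>\<^sup>+x. far k x \<partial>lebesgue) + (\<integral>\<^sup>+x. near k x \<partial>lebesgue))"
      by (subst nn_integral_suminf) (auto simp: nn_integral_add)
    also have "\<dots> \<le> (\<Sum>k. ennreal (inverse (\<rho> k)) * (C + ennreal V))"
      unfolding near distrib_left by (intro suminf_le add_mono far order_refl summableI)
    also have "\<dots> = (\<Sum>k. ennreal (inverse (\<rho> k))) * (C + ennreal V)"
      by (rule ennreal_suminf_multc)
    also have "(\<Sum>k. ennreal (inverse (\<rho> k))) = ennreal (\<Sum>k. inverse (\<rho> k))"
    proof (rule suminf_ennreal2)
      have "summable (\<lambda>k. inverse (2 ^ K) * (1 / 2) ^ k :: real)"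
        by (intro summable_mult summable_geometric) simp
      then show "summable (\<lambda>k. inverse (\<rho> k))"
        by (simp add: \<rho>_def power_add power_one_over field_simps)
    qed (use \<rho>(1) in \<open>simp add: less_imp_le\<close>)
    also have "ennreal (\<Sum>k. inverse (\<rho> k)) * (C + ennreal V) < \<infinity>"
      using C by (simp add: ennreal_mult_less_top)
    finally show ?thesis .
  qed
  ultimately have "(\<integral>\<^sup>+x. inner x + (\<Sum>k. far k x + near k x) \<partial>lebesgue) < \<infinity>"
    by (subst nn_integral_add) auto
  moreover have "(\<integral>\<^sup>+x. ennreal \<bar>u x\<bar> \<partial>lebesgue) \<le> (\<integral>\<^sup>+x. inner x + (\<Sum>k. far k x + near k x) \<partial>lebesgue)"
    by (intro nn_integral_mono pointwise)
  ultimately show ?thesis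
    by (intro integrableI_bounded uM) auto
qed

section \<open>Decay of eigenfunctions\<close>

theorem corollary1p5:
  fixes u :: "real ^ 'n \<Rightarrow> real" and c :: real
  assumes "CARD('n) \<ge> 2"
    and "u \<in> L2_loc"
    and "eigenfunction_neg_laplacian (c\<^sup>2) u"
  shows "\<not> vanishes_infinite_order_at_infinity u \<and>
    (\<exists>N::real. N \<ge> 0 \<and> Limsup at_top (\<lambda>r::real. ennreal (r powr N) * L2_tail u r) = \<infinity>)"
proof -
  let ?weighted = "\<lambda>N r. ennreal (r powr N) * L2_tail u r"
  let ?N = "real (DIM(real ^ 'n) + 2)"
  have weak: "weak_helmholtz (c\<^sup>2) u" and nonzero: "\<not> (AE x in lebesgue. u x = 0)"
    using assms(3) by (auto simp: eigenfunction_neg_laplacian_def)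
  have infinite: "Limsup at_top (?weighted ?N) = \<infinity>"
  proof (rule ccontr)
    assume "Limsup at_top (?weighted ?N) \<noteq> \<infinity>"
    then have "Limsup at_top (?weighted ?N) < \<infinity>" by (simp add: less_top)
    then obtain C where C: "Limsup at_top (?weighted ?N) < C" "C < \<infinity>"
      using dense by blast
    from Limsup_lessD[OF C(1)] have "eventually (\<lambda>r. ?weighted ?N r \<le> C) at_top"
      by (rule eventually_mono) (rule less_imp_le)
    with assms(2) C(2) have "integrable lebesgue u"
      by (rule integrable_of_L2_tail_decay)
    then have "AE x in lebesgue. u x = 0"
      using weak by (intro zero_fourier_imp_AE_zero helmholtz_fourier_zero)
    with nonzero show False by contradiction
  qed
  moreover have "\<not> vanishes_infinite_order_at_infinity u"
  proof
    assume "vanishes_infinite_order_at_infinity u"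
    then have "(?weighted ?N \<longlongrightarrow> 0) at_top"
      unfolding vanishes_infinite_order_at_infinity_def by (auto simp del: of_nat_add)
    then have "Limsup at_top (?weighted ?N) = 0"
      by (intro lim_imp_Limsup) simp
    with infinite show False by simp
  qed
  ultimately show ?thesis
    by (intro conjI exI[of _ ?N]) auto
qed

end
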